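(* Let $\mathcal{F}$ be a tree of finite subsets of $\mathbb{N}$. Then there exists an infinite subset $L$ of $\mathbb{N}$ such that either (i) $[L]^{<\omega}\subseteq\mathcal{F}$; or (ii) there is a countable ordinal $\xi_0$ such that for every infinite subset $I$ of $L$ there exists an initial segment $s$ of $I$ which belongs to $[\mathbb{N}]^{<\omega}\setminus\mathcal{F}$, and which is the unique initial segment of $I$ that belongs to $\mathcal{A}_{\xi_0}$.
   Context: $\mathbb{N}=\{1,2,3,\dots\}$. For $M\subseteq\mathbb{N}$, $[M]^{<\omega}$ is the set of all finite subsets of $M$ (including $\emptyset$). For $s,t\subseteq\mathbb{N}$ nonempty, $s<t$ means $\max s<\min t$; $\{n\}<\emptyset$ is considered true. Initial segments are with respect to the order of $\mathbb{N}$. A family $\mathcal{F}$ of finite subsets of $\mathbb{N}$ is a tree if $\mathcal{F}=\mathcal{F}^\star$, where $\mathcal{F}^{\star}=\{t\in[\mathbb{N}]^{<\omega}: t\text{ is an initial segment of some }s\in\mathcal{F}\}\cup\{\emptyset\}$. The complete thin Schreier system $(\mathcal{A}_\xi)_{\xi<\omega_1}$ of families of finite subsets of $\mathbb{N}$: for every non-zero countable limit ordinal $\lambda$ fix a strictly increasing sequence $(\lambda_n)_{n\ge1}$ of successor ordinals smaller than $\lambda$ with $\sup_n\lambda_n=\lambda$. Define recursively (here $p\,\omega^{\alpha}$ denotes the sum of $p$ copies of $\omega^\alpha$): (1) $\mathcal{A}_0=\{\emptyset\}$. (2) $\mathcal{A}_{\zeta+1}=\{\{n\}\cup s_1: n\in\mathbb{N},\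 \{n\}<s_1,\ s_1\in\mathcal{A}_\zeta\}$. (3) $\mathcal{A}_{\omega^{\beta+1}}=\{\bigcup_{i=1}^n s_i: n=\min s_1,\ s_1<\dots<s_n,\ s_1,\dots,s_n\in\mathcal{A}_{\omega^\beta}\}$ for $\beta$ a countable ordinal. (4) $\mathcal{A}_{\omega^\lambda}=\{s: s\in\mathcal{A}_{\omega^{\lambda_n}}\text{ with }n=\min s\}$ for $\lambda$ a non-zero countable limit ordinal. (5) If $\xi$ is a limit ordinal with $\omega^\alpha<\xi<\omega^{\alpha+1}$ for some $0<\alpha<\omega_1$, write uniquely $\xi=p\,\omega^\alpha+\sum_{i=1}^m p_i\,\omega^{\alpha_i}$ with $m\ge0$, $\alpha>\alpha_1>\dots>\alpha_m>0$, natural numbers $p,p_1,\dots,p_m\ge1$ (either $p>1$, or $p=1$ and $m\ge1$). Then $\mathcal{A}_\xi$ is the family of all $s=s_0\cup\bigcup_{i=1}^m s_i$ with $s_m<\dots<s_1<s_0$, where $s_0=s^0_1\cup\dots\cup s^0_p$ with $s^0_1<\dots<s^0_p$ and all $s^0_j\in\mathcal{A}_{\omega^\alpha}$, and, for $1\le i\le m$, $s_i=s^i_1\cup\dots\cup s^i_{p_i}$ with $s^i_1<\dots<s^i_{p_i}$ and all $s^i_j\in\mathcal{A}_{\omega^{\alpha_i}}$. *)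

theory Defs
  imports "HOL-Library.Countable_Set"
begin

unbundle cardinal_syntax

section \<open>Countable ordinals\<close>

text \<open>
  The countable ordinals are represented by the elements of the first uncountable cardinal,
  that is, of the cardinal successor of the well-order of the natural numbers. The lemmas
  \<open>countable_lessThan_omega1\<close> and \<open>uncountable_UNIV_omega1\<close> below determine this
  well-order up to isomorphism.
\<close>

lemma Card_order_omega1: "Card_order (cardSuc natLeq)"
  by (rule cardSuc_Card_order[OF natLeq_Card_order])

lemma Well_order_omega1: "Well_order (cardSuc natLeq)"
  using Card_order_omega1 unfolding card_order_on_def by blast

lemma Field_omega1_not_countable: "\<not> countable (Field (cardSuc natLeq))"
proof
  assume "countable (Field (cardSuc natLeq))"
  then have "|Field (cardSuc natLeq)| \<le>o natLeq"
    by (meson card_of_nat card_of_ordLeq countableE ordLeq_ordIso_trans subset_UNIV)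
  moreover have "|Field (cardSuc natLeq)| =o cardSuc natLeq"
    by (rule card_of_Field_ordIso[OF Card_order_omega1])
  ultimately have "cardSuc natLeq \<le>o natLeq"
    using ordIso_ordLeq_trans ordIso_symmetric by blast
  with cardSuc_greater[OF natLeq_Card_order] show False
    using not_ordLess_ordLeq by blast
qed

typedef omega1 = "Field (cardSuc natLeq)"
  using Field_omega1_not_countable by (metis countable_empty ex_in_conv)

instantiation omega1 :: linorder
begin

definition less_eq_omega1 :: "omega1 \<Rightarrow> omega1 \<Rightarrow> bool" where
  "x \<le> y \<longleftrightarrow> (Rep_omega1 x, Rep_omega1 y) \<in> cardSuc natLeq"

definition less_omega1 :: "omega1 \<Rightarrow> omega1 \<Rightarrow> bool" where
  "(x :: omega1) < y \<longleftrightarrow> x \<le> y \<and> x \<noteq> y"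

instance
proof
  have wo: "refl_on (Field (cardSuc natLeq)) (cardSuc natLeq)" "trans (cardSuc natLeq)"
    "antisym (cardSuc natLeq)" "total_on (Field (cardSuc natLeq)) (cardSuc natLeq)"
    using Well_order_omega1 unfolding order_on_defs by blast+
  fix x y z :: omega1
  show "x \<le> x"
    using wo(1) Rep_omega1 unfolding less_eq_omega1_def refl_on_def by blast
  show "x \<le> z" if "x \<le> y" "y \<le> z"
    using that wo(2) unfolding less_eq_omega1_def trans_def by blast
  show *: "x = y" if "x \<le> y" "y \<le> x"
    using that wo(3) unfolding less_eq_omega1_def antisym_def by (metis Rep_omega1_inject)
  show "(x < y) = (x \<le> y \<and> \<not> y \<le> x)"
    using * \<open>x \<le> x\<close> unfolding less_omega1_def by blast
  show "x \<le> y \<or> y \<le> x"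
  proof (cases "x = y")
    case False
    then show ?thesis
      using wo(4) Rep_omega1 unfolding less_eq_omega1_def total_on_def
      by (metis Rep_omega1_inject)
  qed (use \<open>x \<le> x\<close> in auto)
qed

end

instance omega1 :: wellorder
proof
  fix P :: "omega1 \<Rightarrow> bool" and a
  assume step: "\<And>x. (\<And>y. y < x \<Longrightarrow> P y) \<Longrightarrow> P x"
  have "wf (cardSuc natLeq - Id)"
    using Well_order_omega1 unfolding well_order_on_def by blast
  then have "wf (inv_image (cardSuc natLeq - Id) Rep_omega1)"
    by (rule wf_inv_image)
  then show "P a"
  proof (induction a rule: wf_induct_rule)
    case (less x)
    show ?case
      by (rule step, rule less)
        (auto simp: inv_image_def less_omega1_def less_eq_omega1_def Rep_omega1_inject)
  qed
qed

lemma uncountable_UNIV_omega1: "\<not> countable (UNIV :: omega1 set)"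
proof
  assume "countable (UNIV :: omega1 set)"
  then have "countable (range Rep_omega1)" by simp
  then show False
    using Field_omega1_not_countable type_definition.Rep_range[OF type_definition_omega1] by simp
qed

lemma countable_lessThan_omega1: "countable {..<x :: omega1}"
proof -
  let ?U = "underS (cardSuc natLeq) (Rep_omega1 x)"
  have "|?U| <o cardSuc natLeq"
    by (rule card_of_underS[OF Card_order_omega1 Rep_omega1])
  then have "|?U| \<le>o natLeq"
    using cardSuc_ordLeq_ordLess[OF natLeq_Card_order card_of_Card_order] by blast
  then have "|?U| \<le>o |UNIV :: nat set|"
    using card_of_nat ordIso_symmetric ordLeq_ordIso_trans by blast
  then have "countable ?U"
    unfolding card_of_ordLeq[symmetric] by (auto intro: countableI)
  moreover have "Rep_omega1 ` {..<x} \<subseteq> ?U"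
    by (auto simp: underS_def less_omega1_def less_eq_omega1_def Rep_omega1_inject)
  ultimately have "countable (Rep_omega1 ` {..<x})"
    using countable_subset by blast
  then show ?thesis
    by (rule countable_image_inj_on) (auto simp: inj_on_def Rep_omega1_inject)
qed

lemma countable_bounded_omega1:
  fixes A :: "omega1 set"
  assumes "countable A"
  shows "\<exists>z. \<forall>x\<in>A. x < z"
proof (rule ccontr)
  assume "\<not> ?thesis"
  then have "UNIV = (\<Union>x\<in>A. insert x {..<x})"
    by (force simp: not_less le_less)
  moreover have "countable (\<Union>x\<in>A. insert x {..<x})"
    using assms by (intro countable_UN countable_insert countable_lessThan_omega1)
  ultimately show False using uncountable_UNIV_omega1 by metis
qed

unbundle no cardinal_syntax

instantiation omega1 :: conditionally_complete_linorder
begin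

definition inf_omega1 :: "omega1 \<Rightarrow> omega1 \<Rightarrow> omega1" where
  "inf_omega1 = min"

definition sup_omega1 :: "omega1 \<Rightarrow> omega1 \<Rightarrow> omega1" where
  "sup_omega1 = max"

definition Inf_omega1 :: "omega1 set \<Rightarrow> omega1" where
  "Inf_omega1 X = (LEAST x. x \<in> X)"

definition Sup_omega1 :: "omega1 set \<Rightarrow> omega1" where
  "Sup_omega1 X = (LEAST z. \<forall>x\<in>X. x \<le> z)"

instance
proof
  fix x z :: omega1 and X :: "omega1 set"
  show "Inf X \<le> x" if "x \<in> X" "bdd_below X"
    using that by (simp add: Inf_omega1_def Least_le)
  show "z \<le> Inf X" if "X \<noteq> {}" "\<And>x. x \<in> X \<Longrightarrow> z \<le> x"
    using that unfolding Inf_omega1_def ex_in_conv[symmetric] by (rule LeastI2_ex)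
  show "x \<le> Sup X" if X: "x \<in> X" "bdd_above X"
  proof -
    obtain u where "\<forall>x\<in>X. x \<le> u"
      using X(2) by (auto simp: bdd_above_def)
    then have "\<forall>x\<in>X. x \<le> Sup X"
      unfolding Sup_omega1_def by (rule LeastI)
    with X(1) show ?thesis by blast
  qed
  show "Sup X \<le> z" if "X \<noteq> {}" "\<And>x. x \<in> X \<Longrightarrow> x \<le> z"
    using that by (simp add: Sup_omega1_def Least_le)
qed (auto simp: inf_omega1_def sup_omega1_def)

end


section \<open>Ordinal arithmetic\<close>

text \<open>The least strict upper bound; it exists for every countable set of countable ordinals.\<close>

definition lsub :: "omega1 set \<Rightarrow> omega1" where
  "lsub A = (LEAST z. \<forall>x\<in>A. x < z)"

lemma lsub_cong [fundef_cong]: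
  "A = B \<Longrightarrow> (\<And>x. x \<in> B \<Longrightarrow> f x = g x) \<Longrightarrow> lsub (f ` A) = lsub (g ` B)"
  by (metis image_cong)

lemma less_lsub: "countable A \<Longrightarrow> x \<in> A \<Longrightarrow> x < lsub A"
  using LeastI_ex[OF countable_bounded_omega1, of A] unfolding lsub_def by blast

lemma lsub_le: "(\<And>x. x \<in> A \<Longrightarrow> x < z) \<Longrightarrow> lsub A \<le> z"
  unfolding lsub_def by (simp add: Least_le)

lemma less_lsub_image: "y < x \<Longrightarrow> f y < lsub (f ` {..<x :: omega1})"
  by (intro less_lsub countable_image countable_lessThan_omega1) simp

instantiation omega1 :: "{zero, one, plus}"
begin

definition zero_omega1 :: omega1 where
  "0 = (LEAST x :: omega1. True)"

definition one_omega1 :: omega1 where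
  "1 = lsub {0 :: omega1}"

function plus_omega1 :: "omega1 \<Rightarrow> omega1 \<Rightarrow> omega1" where
  "plus_omega1 x y = (if y = 0 then x else lsub ((\<lambda>z. plus_omega1 x z) ` {..<y}))"
  by auto
termination
  by (relation "inv_image {(x, y). x < y} snd") (auto simp: wf)

instance ..

end

declare plus_omega1.simps [simp del]

lemma zero_le_omega1 [simp]: "0 \<le> (x :: omega1)"
  unfolding zero_omega1_def by (simp add: Least_le)

lemma not_less_zero_omega1 [simp]: "\<not> x < (0 :: omega1)"
  by (simp add: not_less)

lemma pos_iff_omega1: "0 < (x :: omega1) \<longleftrightarrow> x \<noteq> 0"
  by (metis zero_le_omega1 le_less less_irrefl)

lemma less_one_iff_omega1 [simp]: "x < (1 :: omega1) \<longleftrightarrow> x = 0"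
proof
  assume "x < 1"
  then have "\<not> lsub {0} \<le> x" by (simp add: one_omega1_def not_le)
  then have "\<not> 0 < x" using lsub_le[of "{0}" x] by blast
  then show "x = 0" by (simp add: pos_iff_omega1)
qed (simp add: one_omega1_def less_lsub)

lemma omega1_add_zero: "x + 0 = (x :: omega1)"
  by (simp add: plus_omega1.simps)

lemma omega1_add_eq_lsub: "y \<noteq> 0 \<Longrightarrow> x + y = lsub ((+) x ` {..<y})" for x :: omega1
  by (subst plus_omega1.simps) simp

text \<open>In particular, \<open>x + 1\<close> is the successor of \<open>x\<close>.\<close>

lemma omega1_add_one: "x + 1 = (LEAST z. x < z)" for x :: omega1
proof -
  have "{..<1 :: omega1} = {0}"
    by auto
  moreover have "(1 :: omega1) \<noteq> 0"
    by (metis less_one_iff_omega1 not_less_zero_omega1)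
  ultimately show ?thesis
    by (simp add: omega1_add_eq_lsub omega1_add_zero lsub_def)
qed

lemma less_add_one_omega1: "x < x + 1" for x :: omega1
proof -
  obtain z where "x < z"
    using countable_bounded_omega1[of "{x}"] by auto
  then show ?thesis
    unfolding omega1_add_one by (rule LeastI)
qed

lemma less_add_one_iff_omega1: "x < y + 1 \<longleftrightarrow> x \<le> y" for x y :: omega1
proof
  assume "x < y + 1"
  then have "\<not> y < x"
    unfolding omega1_add_one by (rule not_less_Least)
  then show "x \<le> y" by simp
next
  assume "x \<le> y"
  then show "x < y + 1"
    using less_add_one_omega1 by (rule le_less_trans)
qed

lemma omega1_add_strict_mono:
  fixes x y z :: omega1
  assumes "y < z"
  shows "x + y < x + z"
proof -
  have "z \<noteq> 0" using assms by auto
  then show ?thesis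
    using less_lsub_image[OF assms, of "(+) x"] by (simp add: omega1_add_eq_lsub)
qed

lemma omega1_add_mono: "y \<le> z \<Longrightarrow> x + y \<le> x + z" for x y z :: omega1
  by (auto simp: le_less intro: omega1_add_strict_mono)

lemma omega1_add_le: "x \<le> z \<Longrightarrow> (\<And>w. w < y \<Longrightarrow> x + w < z) \<Longrightarrow> x + y \<le> z" for x y z :: omega1
  by (cases "y = 0") (auto simp: omega1_add_zero omega1_add_eq_lsub intro!: lsub_le)

lemma omega1_zero_add: "0 + y = (y :: omega1)"
proof (induction y rule: less_induct)
  case (less y)
  have "y \<le> 0 + y"
  proof (rule ccontr)
    assume "\<not> y \<le> 0 + y"
    then have "0 + y < y" by simp
    then have "0 + (0 + y) < 0 + y" by (rule omega1_add_strict_mono)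
    moreover have "0 + (0 + y) = 0 + y" using \<open>0 + y < y\<close> by (rule less)
    ultimately show False by simp
  qed
  moreover have "0 + y \<le> y"
    by (rule omega1_add_le) (simp_all add: less)
  ultimately show ?case by (rule antisym[rotated])
qed

text \<open>Existence of right differences.\<close>

lemma omega1_le_imp_add:
  fixes x z :: omega1
  assumes "x \<le> z"
  obtains y where "z = x + y"
proof -
  define y where "y = (LEAST y. z \<le> x + y)"
  have ge: "z \<le> x + z"
  proof (rule ccontr)
    assume "\<not> z \<le> x + z"
    define u where "u = (LEAST u. x + u < u)"
    have u: "x + u < u"
      unfolding u_def by (rule LeastI[of "\<lambda>u. x + u < u" z]) (use \<open>\<not> z \<le> x + z\<close> in simp)
    then have "x + (x + u) < x + u" by (rule omega1_add_strict_mono)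
    then have "u \<le> x + u" unfolding u_def by (rule Least_le[of "\<lambda>u. x + u < u"])
    with u show False by simp
  qed
  then have "z \<le> x + y" unfolding y_def by (rule LeastI[of "\<lambda>y. z \<le> x + y"])
  moreover have "x + w < z" if "w < y" for w
    using not_less_Least[OF that[unfolded y_def]] by (simp add: not_le)
  then have "x + y \<le> z" using assms by (intro omega1_add_le)
  ultimately have "z = x + y" by (intro antisym)
  then show ?thesis by (rule that)
qed

instance omega1 :: monoid_add
proof
  fix a b c :: omega1
  show "a + b + c = a + (b + c)"
  proof (induction c rule: less_induct)
    case (less c)
    show ?case
    proof (rule antisym)
      have "b \<le> b + c" using omega1_add_mono[of 0 c b] by (simp add: omega1_add_zero)
      then have "a + b \<le> a + (b + c)" by (rule omega1_add_mono)
      then show "a + b + c \<le> a + (b + c)"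
        by (rule omega1_add_le) (auto simp: less omega1_add_mono omega1_add_strict_mono)
    next
      have ab: "a + b \<le> a + b + c"
        using omega1_add_mono[of 0 c "a + b"] by (simp add: omega1_add_zero)
      show "a + (b + c) \<le> a + b + c"
      proof (rule omega1_add_le)
        have "a \<le> a + b" using omega1_add_mono[of 0 b a] by (simp add: omega1_add_zero)
        with ab show "a \<le> a + b + c" by simp
      next
        fix w assume w: "w < b + c"
        show "a + w < a + b + c"
        proof (cases "w < b")
          case True
          then show ?thesis using ab omega1_add_strict_mono less_le_trans by blast
        next
          case False
          then obtain d where d: "w = b + d"
            using omega1_le_imp_add by (metis not_less)
          with w have "d < c" by (metis not_less omega1_add_mono)
          then show ?thesis using less d omega1_add_strict_mono by metis
        qed
      qed
    qed
  qed
qed (simp_all add: omega1_add_zero omega1_zero_add)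

definition succ_ord :: "omega1 \<Rightarrow> bool" where
  "succ_ord x \<longleftrightarrow> (\<exists>y. x = y + 1)"

definition limit_ord :: "omega1 \<Rightarrow> bool" where
  "limit_ord x \<longleftrightarrow> x \<noteq> 0 \<and> \<not> succ_ord x"

lemma limit_ord_add_one_less: "limit_ord x \<Longrightarrow> y < x \<Longrightarrow> y + 1 < x"
  using less_add_one_iff_omega1[of x y]
  by (auto simp: limit_ord_def succ_ord_def not_less le_less[of "y + 1"] neq_iff)

lemma bdd_above_omega1: "countable A \<Longrightarrow> bdd_above (A :: omega1 set)"
  using countable_bounded_omega1 unfolding bdd_above_def by (meson less_imp_le)

lemma omega1_add_succ: "x + (y + 1) = (x + y) + 1" for x y :: omega1
  by (simp add: add.assoc)

lemma omega1_add_limit: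
  assumes "limit_ord y"
  shows "x + y = (SUP z\<in>{..<y}. x + z)"
proof (rule antisym)
  have y: "0 < y" using assms by (simp add: limit_ord_def pos_iff_omega1)
  have b: "bdd_above ((+) x ` {..<y})"
    by (intro bdd_above_omega1 countable_image countable_lessThan_omega1)
  have le: "x + z \<le> (SUP z\<in>{..<y}. x + z)" if "z < y" for z
    using b that by (intro cSUP_upper) auto
  show "x + y \<le> (SUP z\<in>{..<y}. x + z)"
  proof (rule omega1_add_le)
    show "x \<le> (SUP z\<in>{..<y}. x + z)" using le[OF y] by simp
    fix w assume "w < y"
    have "x + w < x + (w + 1)" by (intro omega1_add_strict_mono less_add_one_omega1)
    also have "\<dots> \<le> (SUP z\<in>{..<y}. x + z)"
      by (intro le limit_ord_add_one_less assms \<open>w < y\<close>)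
    finally show "x + w < (SUP z\<in>{..<y}. x + z)" .
  qed
  show "(SUP z\<in>{..<y}. x + z) \<le> x + y"
    using y by (intro cSUP_least) (auto intro: less_imp_le omega1_add_strict_mono)
qed

text \<open>The sum of \<open>p\<close> copies of \<open>x\<close>.\<close>

definition copies :: "nat \<Rightarrow> omega1 \<Rightarrow> omega1" where
  "copies p x = sum_list (replicate p x)"

text \<open>
  The powers of \<open>\<omega>\<close>. Successor and limit exponents are treated by one formula; the usual
  recursion clauses are the three lemmas after the definition.
\<close>

lemma SUP_cong_omega1 [fundef_cong]:
  "A = B \<Longrightarrow> (\<And>x. x \<in> B \<Longrightarrow> f x = g x) \<Longrightarrow> (SUP x\<in>A. f x :: omega1) = (SUP x\<in>B. g x)"
  by (metis image_cong)

function omega_pow :: "omega1 \<Rightarrow> omega1" where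
  "omega_pow a = (if a = 0 then 1 else SUP b\<in>{..<a}. SUP n. copies n (omega_pow b))"
  by auto
termination
  by (relation "{(x, y). x < y}") (auto simp: wf)

declare omega_pow.simps [simp del]

lemma omega_pow_zero: "omega_pow 0 = 1"
  by (simp add: omega_pow.simps)

lemma copies_le_omega_pow:
  assumes "b < a"
  shows "copies n (omega_pow b) \<le> omega_pow a"
proof -
  have "copies n (omega_pow b) \<le> (SUP n. copies n (omega_pow b))"
    by (intro cSUP_upper bdd_above_omega1) auto
  also have "\<dots> \<le> (SUP b\<in>{..<a}. SUP n. copies n (omega_pow b))"
    using assms by (intro cSUP_upper bdd_above_omega1 countable_image countable_lessThan_omega1) auto
  also have "\<dots> = omega_pow a"
    using assms by (subst (2) omega_pow.simps) auto
  finally show ?thesis .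
qed

lemma omega_pow_mono: "a \<le> b \<Longrightarrow> omega_pow a \<le> omega_pow b"
  using copies_le_omega_pow[of a b 1] by (auto simp: le_less copies_def)

lemma copies_mono: "x \<le> y \<Longrightarrow> copies n x \<le> copies n y"
proof (induction n)
  case (Suc n)
  have mono_left: "u + w \<le> v + w" if "u \<le> v" for u v w :: omega1
    using that
  proof (induction w rule: less_induct)
    case (less w)
    have "v \<le> v + w" using omega1_add_mono[of 0 w v] by simp
    then show ?case
      using less by (intro omega1_add_le) (auto intro: le_less_trans omega1_add_strict_mono)
  qed
  show ?case
    using Suc mono_left[of x y] omega1_add_mono[of "copies n x" "copies n y" y]
    by (auto simp: copies_def intro: order_trans)
qed (simp add: copies_def)

lemma omega_pow_succ: "omega_pow (a + 1) = (SUP n. copies n (omega_pow a))"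
proof (rule antisym)
  have "a + 1 \<noteq> 0" using less_add_one_omega1[of a] by auto
  then have "omega_pow (a + 1) = (SUP b\<in>{..<a + 1}. SUP n. copies n (omega_pow b))"
    by (subst omega_pow.simps) simp
  also have "\<dots> \<le> (SUP n. copies n (omega_pow a))"
  proof (rule cSUP_least)
    show "{..<a + 1} \<noteq> {}" using less_add_one_omega1 by blast
    fix b assume "b \<in> {..<a + 1}"
    then have "b \<le> a" by (simp add: less_add_one_iff_omega1)
    then show "(SUP n. copies n (omega_pow b)) \<le> (SUP n. copies n (omega_pow a))"
      by (intro cSUP_mono bdd_above_omega1)
        (auto intro: copies_mono omega_pow_mono)
  qed
  finally show "omega_pow (a + 1) \<le> (SUP n. copies n (omega_pow a))" .
  show "(SUP n. copies n (omega_pow a)) \<le> omega_pow (a + 1)"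
    by (intro cSUP_least copies_le_omega_pow less_add_one_omega1) auto
qed

lemma omega_pow_limit:
  assumes "limit_ord a"
  shows "omega_pow a = (SUP b\<in>{..<a}. omega_pow b)"
proof (rule antisym)
  have a: "a \<noteq> 0" "0 < a" using assms by (simp_all add: limit_ord_def pos_iff_omega1)
  have "omega_pow a = (SUP b\<in>{..<a}. SUP n. copies n (omega_pow b))"
    using a by (subst omega_pow.simps) simp
  also have "\<dots> = (SUP b\<in>{..<a}. omega_pow (b + 1))"
    by (simp add: omega_pow_succ)
  also have "\<dots> \<le> (SUP b\<in>{..<a}. omega_pow b)"
    using a by (intro cSUP_least cSUP_upper bdd_above_omega1 countable_image countable_lessThan_omega1)
      (auto intro: limit_ord_add_one_less[OF assms])
  finally show "omega_pow a \<le> (SUP b\<in>{..<a}. omega_pow b)" .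
  show "(SUP b\<in>{..<a}. omega_pow b) \<le> omega_pow a"
    using a by (intro cSUP_least omega_pow_mono) auto
qed

lemma copies_Suc: "copies (Suc n) x = copies n x + x"
  by (induction n) (simp_all add: copies_def flip: add.assoc)

lemma omega_pow_pos: "0 < omega_pow a"
proof -
  have "0 < (1 :: omega1)" by simp
  also have "1 \<le> omega_pow a"
    using omega_pow_mono[of 0 a] by (simp add: omega_pow_zero)
  finally show ?thesis .
qed

lemma copies_less_omega_pow:
  assumes "b < a"
  shows "copies n (omega_pow b) < omega_pow a"
proof -
  have "copies n (omega_pow b) < copies (Suc n) (omega_pow b)"
    using omega1_add_strict_mono[OF omega_pow_pos, of "copies n (omega_pow b)" b]
    by (simp add: copies_Suc)
  also have "\<dots> \<le> omega_pow a"
    by (rule copies_le_omega_pow[OF assms])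
  finally show ?thesis .
qed

lemma omega_pow_less_iff [simp]: "omega_pow a < omega_pow b \<longleftrightarrow> a < b"
proof
  show "a < b" if "omega_pow a < omega_pow b"
    using that omega_pow_mono[of b a] by (metis not_le)
  show "omega_pow a < omega_pow b" if "a < b"
    using copies_less_omega_pow[OF that, of 1] by (simp add: copies_def)
qed

lemma omega_pow_eq_iff [simp]: "omega_pow a = omega_pow b \<longleftrightarrow> a = b"
  by (metis omega_pow_less_iff less_irrefl linorder_less_linear)

lemma limit_ord_omega_pow:
  assumes "0 < a"
  shows "limit_ord (omega_pow a)"
proof -
  have "omega_pow a \<noteq> y + 1" for y
  proof
    assume y: "omega_pow a = y + 1"
    have "omega_pow a = (SUP b\<in>{..<a}. SUP n. copies n (omega_pow b))"
      using assms by (subst omega_pow.simps) auto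
    also have "\<dots> \<le> y"
    proof (intro cSUP_least)
      fix b n assume "b \<in> {..<a}"
      then have "copies n (omega_pow b) < omega_pow a"
        by (simp add: copies_less_omega_pow)
      then show "copies n (omega_pow b) \<le> y"
        by (simp add: y less_add_one_iff_omega1)
    qed (use assms in auto)
    finally show False
      using less_add_one_omega1[of y] y by simp
  qed
  then show ?thesis
    using omega_pow_pos[of a] by (auto simp: limit_ord_def succ_ord_def)
qed


section \<open>Finite subsets of the positive integers\<close>

text \<open>
  Zero is excluded: the ground set is \<open>{1..}\<close>. The set of finite subsets of \<open>M\<close> is
  \<open>Fpow M\<close>.
\<close>

definition init_seg :: "nat set \<Rightarrow> nat set \<Rightarrow> bool" where
  "init_seg t s \<longleftrightarrow> t \<subseteq> s \<and> (\<forall>x\<in>t. \<forall>y\<in>s. y < x \<longrightarrow> y \<in> t)"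

definition star :: "nat set set \<Rightarrow> nat set set" where
  "star F = {t \<in> Fpow {1..}. \<exists>s\<in>F. init_seg t s} \<union> {{}}"

definition is_tree :: "nat set set \<Rightarrow> bool" where
  "is_tree F \<longleftrightarrow> F \<subseteq> Fpow {1..} \<and> F = star F"

text \<open>Only used for finite sets. The second argument may be empty.\<close>

definition before :: "nat set \<Rightarrow> nat set \<Rightarrow> bool"  (infix "\<lless>" 50) where
  "s \<lless> t \<longleftrightarrow> s \<noteq> {} \<and> (t = {} \<or> Max s < Min t)"


section \<open>The complete thin Schreier system\<close>

definition fundamental_sequences :: "(omega1 \<Rightarrow> nat \<Rightarrow> omega1) \<Rightarrow> bool" where
  "fundamental_sequences lam \<longleftrightarrow>
     (\<forall>l. limit_ord l \<longrightarrow>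
        strict_mono_on {1..} (lam l) \<and>
        (\<forall>n\<ge>1. succ_ord (lam l n) \<and> lam l n < l) \<and>
        (SUP n\<in>{1..}. lam l n) = l)"

text \<open>
  The ordinals in the conclusions of the five rules are pairwise distinct, so that this
  inductive definition is the same as the recursion on the ordinal; the first four
  recursion equations are proved below. In the last rule,
  \<open>a 0 > \<dots> > a m > 0\<close> are the exponents and \<open>p 0, \<dots>, p m\<close> the coefficients of the Cantor
  normal form of \<open>x\<close>; \<open>t i\<close> is the union of the \<open>p i\<close> successive sets \<open>s i 1, \<dots>, s i (p i)\<close>,
  and the \<open>t i\<close> are arranged in the order \<open>t m, \<dots>, t 0\<close>. The strict inequality
  \<open>omega_pow (a 0) < x\<close> excludes \<open>m = 0, p 0 = 1\<close>.
\<close>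

inductive schreier :: "(omega1 \<Rightarrow> nat \<Rightarrow> omega1) \<Rightarrow> omega1 \<Rightarrow> nat set \<Rightarrow> bool"
  for lam :: "omega1 \<Rightarrow> nat \<Rightarrow> omega1" where
  zero: "schreier lam 0 {}"
| succ: "\<lbrakk>1 \<le> n; {n} \<lless> s; schreier lam z s\<rbrakk> \<Longrightarrow> schreier lam (z + 1) ({n} \<union> s)"
| omega_succ:
    "\<lbrakk>1 \<le> n; n = Min (s 1);
      \<forall>i\<in>{1..<n}. s i \<lless> s (i + 1);
      \<forall>i\<in>{1..n}. schreier lam (omega_pow b) (s i)\<rbrakk>
     \<Longrightarrow> schreier lam (omega_pow (b + 1)) (\<Union>i\<in>{1..n}. s i)"
| omega_limit:
    "\<lbrakk>limit_ord l; s \<noteq> {}; schreier lam (omega_pow (lam l (Min s))) s\<rbrakk>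
     \<Longrightarrow> schreier lam (omega_pow l) s"
| sum:
    "\<lbrakk>limit_ord x; omega_pow (a 0) < x; x < omega_pow (a 0 + 1);
      x = (\<Sum>i\<leftarrow>[0..<m + 1]. copies (p i) (omega_pow (a i)));
      \<forall>i<m. a (i + 1) < a i; 0 < a m; \<forall>i\<le>m. 1 \<le> p i;
      \<forall>i\<le>m. \<forall>j\<in>{1..p i}. schreier lam (omega_pow (a i)) (s i j);
      \<forall>i\<le>m. \<forall>j\<in>{1..<p i}. s i j \<lless> s i (j + 1);
      \<forall>i\<le>m. t i = (\<Union>j\<in>{1..p i}. s i j);
      \<forall>i<m. t (i + 1) \<lless> t i\<rbrakk>
     \<Longrightarrow> schreier lam x (\<Union>i\<le>m. t i)"

definition thin_family :: "(omega1 \<Rightarrow> nat \<Rightarrow> omega1) \<Rightarrow> omega1 \<Rightarrow> nat set set" where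
  "thin_family lam x = {s. schreier lam x s}"

lemma not_limit_ord: "\<not> limit_ord 0" "\<not> limit_ord (x + 1)"
  by (auto simp: limit_ord_def succ_ord_def)

lemma succ_pos_omega1: "0 < x + (1 :: omega1)"
  using zero_le_omega1 less_add_one_omega1 by (rule le_less_trans)

lemma thin_family_zero: "thin_family lam 0 = {{}}"
proof -
  have "u = {}" if "schreier lam 0 u" for u
    using that
  proof cases
    case zero
    then show ?thesis by simp
  next
    case (succ n s z)
    then show ?thesis using succ_pos_omega1[of z] by simp
  next
    case (omega_succ n s b)
    then show ?thesis using omega_pow_pos[of "b + 1"] by simp
  next
    case (omega_limit l)
    then show ?thesis using omega_pow_pos[of l] by simp
  next
    case (sum a m p s t)
    then show ?thesis using not_limit_ord by simp
  qed
  then show ?thesis by (auto simp: thin_family_def intro: schreier.zero)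
qed

lemma add_one_inject_omega1: "x + 1 = y + 1 \<longleftrightarrow> x = (y :: omega1)"
  by (metis less_add_one_iff_omega1 order.antisym order_refl)

lemma thin_family_succ:
  "thin_family lam (z + 1) =
     {{n} \<union> s |n s. 1 \<le> n \<and> {n} \<lless> s \<and> s \<in> thin_family lam z}"
proof -
  have "\<exists>n s. u = {n} \<union> s \<and> 1 \<le> n \<and> {n} \<lless> s \<and> schreier lam z s"
    if "schreier lam (z + 1) u" for u
    using that
  proof cases
    case zero
    then show ?thesis using succ_pos_omega1[of z] by simp
  next
    case (succ n s z')
    then show ?thesis by (auto simp: add_one_inject_omega1)
  next
    case (omega_succ n s b)
    then have "limit_ord (z + 1)" by (simp only: limit_ord_omega_pow succ_pos_omega1)
    then show ?thesis by (simp add: not_limit_ord)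
  next
    case (omega_limit l)
    then have "0 < l" by (simp add: limit_ord_def pos_iff_omega1)
    with omega_limit(1) have "limit_ord (z + 1)" by (simp only: limit_ord_omega_pow)
    then show ?thesis by (simp add: not_limit_ord)
  next
    case (sum a m p s t)
    show ?thesis using \<open>limit_ord (z + 1)\<close> by (simp add: not_limit_ord)
  qed
  then show ?thesis
    unfolding thin_family_def mem_Collect_eq
    by (intro Collect_cong iffI) (assumption, elim exE conjE, simp only: schreier.succ)
qed

lemma not_between_omega_pow: "omega_pow a < omega_pow b \<Longrightarrow> \<not> omega_pow b < omega_pow (a + 1)"
  by (simp add: less_add_one_iff_omega1 not_le)

lemma thin_family_omega_succ:
  "thin_family lam (omega_pow (b + 1)) =
     {\<Union>i\<in>{1..n}. s i |n s. 1 \<le> n \<and> n = Min (s 1) \<and> (\<forall>i\<in>{1..<n}. s i \<lless> s (i + 1)) \<and>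
        (\<forall>i\<in>{1..n}. s i \<in> thin_family lam (omega_pow b))}"
proof -
  have "\<exists>n s. u = (\<Union>i\<in>{1..n}. s i) \<and> 1 \<le> n \<and> n = Min (s 1) \<and>
      (\<forall>i\<in>{1..<n}. s i \<lless> s (i + 1)) \<and> (\<forall>i\<in>{1..n}. schreier lam (omega_pow b) (s i))"
    if "schreier lam (omega_pow (b + 1)) u" for u
    using that
  proof cases
    case zero
    then show ?thesis using omega_pow_pos[of "b + 1"] by simp
  next
    case (succ n s z)
    have "limit_ord (z + 1)"
      unfolding succ(1)[symmetric] by (intro limit_ord_omega_pow succ_pos_omega1)
    then show ?thesis by (simp add: not_limit_ord)
  next
    case (omega_succ n s b')
    then show ?thesis by (auto simp: add_one_inject_omega1)
  next
    case (omega_limit l)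
    then show ?thesis using not_limit_ord(2)[of b] by simp
  next
    case (sum a m p s t)
    show ?thesis
      using not_between_omega_pow[OF \<open>omega_pow (a 0) < omega_pow (b + 1)\<close>]
        \<open>omega_pow (b + 1) < omega_pow (a 0 + 1)\<close> by contradiction
  qed
  then show ?thesis
    unfolding thin_family_def mem_Collect_eq
    by (intro Collect_cong iffI) (assumption, elim exE conjE, simp only: schreier.omega_succ)
qed

lemma thin_family_omega_limit:
  assumes "limit_ord l"
  shows "thin_family lam (omega_pow l) =
    {s. s \<noteq> {} \<and> s \<in> thin_family lam (omega_pow (lam l (Min s)))}"
proof -
  have "u \<noteq> {} \<and> schreier lam (omega_pow (lam l (Min u))) u"
    if "schreier lam (omega_pow l) u" for u
    using that
  proof cases
    case zero
    then show ?thesis using omega_pow_pos[of l] by simp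
  next
    case (succ n s z)
    have "0 < l" using assms by (simp add: limit_ord_def pos_iff_omega1)
    then have "limit_ord (z + 1)"
      unfolding succ(1)[symmetric] by (rule limit_ord_omega_pow)
    then show ?thesis by (simp add: not_limit_ord)
  next
    case (omega_succ n s b)
    then show ?thesis using assms not_limit_ord(2)[of b] by simp
  next
    case (omega_limit l')
    then show ?thesis by simp
  next
    case (sum a m p s t)
    show ?thesis
      using not_between_omega_pow[OF \<open>omega_pow (a 0) < omega_pow (l)\<close>]
        \<open>omega_pow (l) < omega_pow (a 0 + 1)\<close> by contradiction
  qed
  then show ?thesis
    using assms by (auto simp: thin_family_def intro: schreier.omega_limit)
qed

end

theory Submission
  imports Defs
begin

text \<open>
  Galvin's lemma is applied twice. Applied to the complement of \<open>F\<close> it gives either (i) or an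
  infinite \<open>M\<close> inside which \<open>F\<close> has no infinite branch. In the second case some family
  \<open>thin_family lam (omega_pow a)\<close> has a member outside \<open>F\<close> inside every infinite subset of
  \<open>M\<close>: otherwise, as there are uncountably many \<open>a\<close> but only countably many finite sets, an
  infinite branch could be built block by block. Galvin's lemma for the members of that family
  outside \<open>F\<close> then gives (ii), where uniqueness holds because the family is thin. Only indices
  that are powers of \<open>\<omega>\<close> occur.
\<close>

section \<open>Galvin's lemma\<close>

abbreviation below :: "nat set \<Rightarrow> nat set \<Rightarrow> bool" where
  "below s t \<equiv> \<forall>x\<in>s. \<forall>y\<in>t. x < y"

section \<open>Tails of infinite sets and initial segments\<close>

lemma infinite_tail: "infinite M \<Longrightarrow> infinite (M \<inter> {n::nat<..})"
proof
  assume "infinite M" "finite (M \<inter> {n<..})"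
  then have "finite (M \<inter> {n<..} \<union> {..n})" by simp
  moreover have "M \<subseteq> M \<inter> {n<..} \<union> {..n}" by auto
  ultimately show False using \<open>infinite M\<close> finite_subset by blast
qed

lemma infinite_above:
  assumes "infinite M" "finite s"
  shows "infinite {n\<in>M. below s {n}}"
proof -
  obtain k where "\<forall>x\<in>s. x \<le> k" using assms(2) finite_nat_set_iff_bounded_le by blast
  then have "M \<inter> {k<..} \<subseteq> {n\<in>M. below s {n}}" by force
  then show ?thesis using infinite_tail[OF assms(1)] finite_subset by blast
qed

lemma init_seg_refl: "init_seg s s"
  by (auto simp: init_seg_def)

lemma init_seg_trans: "init_seg s t \<Longrightarrow> init_seg t u \<Longrightarrow> init_seg s u"
  unfolding init_seg_def by blast

lemma init_seg_Un_below: "below s t \<Longrightarrow> init_seg s (s \<union> t)"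
  unfolding init_seg_def by fastforce

text \<open>A diagonal argument. Each set of a decreasing sequence serves at once the finitely many
  \<open>s\<close> bounded by the minimum of its predecessor, and these minima form the result. By
  \<open>mono\<close> only the part of a set above \<open>s\<close> matters, and beyond
  \<open>s\<close> the minima all lie in the set that was chosen for \<open>s\<close>.\<close>

lemma fusion:
  fixes P :: "nat set \<Rightarrow> nat set \<Rightarrow> bool"
  assumes M: "infinite M"
    and ex: "\<And>s N. finite s \<Longrightarrow> s \<subseteq> M \<Longrightarrow> infinite N \<Longrightarrow> N \<subseteq> M \<Longrightarrow> \<exists>N'\<subseteq>N. infinite N' \<and> P s N'"
    and mono: "\<And>s N N'. finite s \<Longrightarrow> P s N \<Longrightarrow> infinite N' \<Longrightarrow> {n\<in>N'. below s {n}} \<subseteq> N \<Longrightarrow> P s N'"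
  obtains N where "N \<subseteq> M" "infinite N" "\<And>s. finite s \<Longrightarrow> s \<subseteq> N \<Longrightarrow> P s N"
proof -
  have many: "\<exists>N'\<subseteq>N. infinite N' \<and> (\<forall>s\<in>S. P s N')"
    if S: "finite S" "\<forall>s\<in>S. finite s \<and> s \<subseteq> M" and N: "infinite N" "N \<subseteq> M" for S N
    using S
  proof (induction S rule: finite_induct)
    case empty
    then show ?case using N by auto
  next
    case (insert s S)
    then obtain N1 where N1: "N1 \<subseteq> N" "infinite N1" "\<forall>s\<in>S. P s N1" by auto
    have "\<exists>N'\<subseteq>N1. infinite N' \<and> P s N'"
      by (rule ex) (use N1 N insert.prems in auto)
    then obtain N2 where N2: "N2 \<subseteq> N1" "infinite N2" "P s N2" by blast
    have "P s' N2" if "s' \<in> S" for s'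
      by (rule mono[of s' N1]) (use N1 N2 that insert.prems in auto)
    then show ?case using N1 N2 by (intro exI[of _ N2]) auto
  qed
  define next_set where "next_set X X' \<longleftrightarrow> X' \<subseteq> X \<inter> {Inf X<..} \<and> infinite X' \<and>
      (\<forall>s \<in> Pow ({..Inf X} \<inter> M). P s X')" for X X'
  have "\<exists>X'. next_set X X'"
    if "infinite X \<and> X \<subseteq> M" for X
    unfolding next_set_def
  proof -
    have "finite s" if "s \<in> Pow ({..Inf X} \<inter> M)" for s
      using that finite_subset[of s "{..Inf X}"] by auto
    then show "\<exists>X'\<subseteq>X \<inter> {Inf X<..}. infinite X' \<and> (\<forall>s\<in>Pow ({..Inf X} \<inter> M). P s X')"
      using that infinite_tail[of X] by (intro many) auto
  qed
  then obtain f where "\<And>X. infinite X \<Longrightarrow> X \<subseteq> M \<Longrightarrow> next_set X (f X)"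
    by metis
  note f = this[unfolded next_set_def]
  \<comment> \<open>The empty set has to be served before the start: every number is above it, so
    even the first minimum must come from a set satisfying \<open>P {}\<close>.\<close>
  obtain X0 where X0: "X0 \<subseteq> M" "infinite X0" "P {} X0"
    using ex[of "{}" M] M by auto
  define X where "X k = (f ^^ k) X0" for k
  define n where "n k = Inf (X k)" for k
  have X: "infinite (X k) \<and> X k \<subseteq> M" for k
  proof (induction k)
    case 0
    then show ?case using X0 by (simp add: X_def)
  next
    case (Suc k)
    then show ?case using f[of "X k"] by (auto simp: X_def)
  qed
  have step: "X (Suc k) \<subseteq> X k \<inter> {n k<..}" "\<forall>s \<in> Pow ({..n k} \<inter> M). P s (X (Suc k))" for k
    using f[of "X k"] X[of k] by (auto simp: X_def n_def)
  have antimono: "X l \<subseteq> X k" if "k \<le> l" for k l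
    using lift_Suc_antimono_le[of X k l] step(1) that by blast
  have nX: "n k \<in> X k" for k
    unfolding n_def using X[of k] by (intro Inf_nat_def1) auto
  have "n k < n (Suc k)" for k
    using nX[of "Suc k"] step(1)[of k] by auto
  then have sm: "strict_mono n" by (simp add: strict_mono_Suc_iff)
  show ?thesis
  proof (rule that)
    show "range n \<subseteq> M" using nX X by blast
    show inf: "infinite (range n)"
      using sm by (simp add: finite_image_iff strict_mono_imp_inj_on)
    fix s assume s: "finite s" "s \<subseteq> range n"
    show "P s (range n)"
    proof (cases "s = {}")
      case True
      have "range n \<subseteq> X0"
        using nX antimono[of 0] by (auto simp: X_def)
      then show ?thesis using True X0 mono[of "{}" X0 "range n"] inf by auto
    next
      case False
      then have "Max s \<in> range n" using s Max_in by blast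
      then obtain k where k: "Max s = n k" by blast
      have "s \<subseteq> {..n k}" using s(1) by (auto simp flip: k)
      moreover have "s \<subseteq> M" using s(2) nX X by blast
      ultimately have "P s (X (Suc k))" using step(2) by blast
      \<comment> \<open>Later minima belong to \<open>X (Suc k)\<close> because the sets decrease;
        this is what \<open>mono\<close> asks for.\<close>
      moreover have "{m \<in> range n. below s {m}} \<subseteq> X (Suc k)"
      proof
        fix m assume "m \<in> {m \<in> range n. below s {m}}"
        then obtain l where l: "m = n l" "n k < n l"
          using Max_in[OF s(1) False] k by auto
        then have "Suc k \<le> l" using sm by (simp add: strict_mono_less)
        then show "m \<in> X (Suc k)" using nX[of l] antimono[of "Suc k" l] l(1) by blast
      qed
      ultimately show ?thesis using mono[OF s(1) _ inf] by blast
    qed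
  qed
qed

text \<open>This is acceptance in the combinatorial forcing of Nash-Williams and Galvin. Rejection
  of \<open>s\<close> by \<open>N\<close> means that no infinite subset of \<open>N\<close> accepts
  \<open>s\<close>.\<close>

definition accepts :: "nat set set \<Rightarrow> nat set \<Rightarrow> nat set \<Rightarrow> bool" where
  "accepts G s M \<longleftrightarrow> (\<forall>I\<subseteq>M. infinite I \<and> below s I \<longrightarrow> (\<exists>t\<in>G. init_seg t (s \<union> I)))"

lemma accepts_mono: "accepts G s M \<Longrightarrow> {n\<in>N. below s {n}} \<subseteq> M \<Longrightarrow> accepts G s N"
  unfolding accepts_def
proof (intro allI impI)
  fix I assume *: "\<forall>I\<subseteq>M. infinite I \<and> below s I \<longrightarrow> (\<exists>t\<in>G. init_seg t (s \<union> I))"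
    "{n\<in>N. below s {n}} \<subseteq> M" "I \<subseteq> N" "infinite I \<and> below s I"
  then have "I \<subseteq> {n\<in>N. below s {n}}" by auto
  with * show "\<exists>t\<in>G. init_seg t (s \<union> I)" by (meson order_trans)
qed

text \<open>A first fusion yields \<open>D\<close> that accepts or rejects each of its finite
  subsets. If \<open>D\<close> accepts the empty set, the second alternative holds. Otherwise a
  second fusion thins \<open>D\<close> to \<open>L\<close> so that rejection survives adding a
  larger element of \<open>L\<close>. By induction every finite subset of \<open>L\<close> is then
  rejected, whereas a member of \<open>G\<close> would be accepted at once, being an initial segment
  of all its extensions.\<close>

lemma galvin:
  assumes M: "infinite M"
  obtains L where "L \<subseteq> M" "infinite L" "Fpow L \<inter> G = {}"
  | L where "L \<subseteq> M" "infinite L" "\<And>I. I \<subseteq> L \<Longrightarrow> infinite I \<Longrightarrow> \<exists>t\<in>G. init_seg t I"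
proof -
  define decides where "decides s N \<longleftrightarrow> accepts G s N \<or> (\<forall>N'\<subseteq>N. infinite N' \<longrightarrow> \<not> accepts G s N')"
    for s N :: "nat set"
  obtain D where D: "D \<subseteq> M" "infinite D" "\<And>s. finite s \<Longrightarrow> s \<subseteq> D \<Longrightarrow> decides s D"
  proof (rule fusion[of M decides])
    fix s N :: "nat set" assume "finite s" "infinite N"
    then show "\<exists>N'\<subseteq>N. infinite N' \<and> decides s N'"
      unfolding decides_def by blast
  next
    fix s N N' assume *: "finite s" "decides s N" "infinite N'" "{n\<in>N'. below s {n}} \<subseteq> N"
    show "decides s N'"
      unfolding decides_def
    proof (cases "accepts G s N")
      case True
      then show "accepts G s N' \<or> (\<forall>K\<subseteq>N'. infinite K \<longrightarrow> \<not> accepts G s K)"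
        using *(4) accepts_mono by blast
    next
      case False
      have "\<not> accepts G s K" if K: "K \<subseteq> N'" "infinite K" for K
      proof
        assume "accepts G s K"
        \<comment> \<open>Cutting \<open>K\<close> down to its part above \<open>s\<close> brings it
          inside \<open>N\<close>, where \<open>s\<close> is rejected.\<close>
        then have "accepts G s {n\<in>K. below s {n}}"
          by (rule accepts_mono) auto
        moreover have "{n\<in>K. below s {n}} \<subseteq> N" using *(4) K by blast
        ultimately show False
          using False *(2) infinite_above[OF K(2) *(1)] unfolding decides_def by blast
      qed
      then show "accepts G s N' \<or> (\<forall>K\<subseteq>N'. infinite K \<longrightarrow> \<not> accepts G s K)" by blast
    qed
  qed (use M in auto)
  show ?thesis
  proof (cases "accepts G {} D")
    case True
    then show ?thesis using that(2)[of D] D by (auto simp: accepts_def)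
  next
    case False
    define P where "P s N \<longleftrightarrow> (\<not> accepts G s D \<longrightarrow> (\<forall>n\<in>N. below s {n} \<longrightarrow> \<not> accepts G (insert n s) D))"
      for s N :: "nat set"
    obtain L where L: "L \<subseteq> D" "infinite L" "\<And>s. finite s \<Longrightarrow> s \<subseteq> L \<Longrightarrow> P s L"
    proof (rule fusion[of D P])
      fix s N assume s: "finite s" "s \<subseteq> D" "infinite N" "N \<subseteq> D"
      show "\<exists>N'\<subseteq>N. infinite N' \<and> P s N'"
      proof (cases "accepts G s D")
        case True
        then show ?thesis using s by (auto simp: P_def)
      next
        case False
        \<comment> \<open>The exceptional points. An infinite subset of \<open>K\<close> above
          \<open>s\<close> consists of its minimum \<open>n\<close> and a remainder to which
          acceptance of \<open>insert n s\<close> applies. Hence \<open>K\<close> accepts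
          \<open>s\<close>, so \<open>K\<close> must be finite, and discarding it from
          \<open>N\<close> is harmless.\<close>
        define K where "K = {n\<in>N. below s {n} \<and> accepts G (insert n s) D}"
        have "accepts G s K"
          unfolding accepts_def
        proof (intro allI impI)
          fix I assume I: "I \<subseteq> K" "infinite I \<and> below s I"
          define n where "n = Inf I"
          have n: "n \<in> I" "\<And>m. m \<in> I \<Longrightarrow> n \<le> m"
            using I by (auto simp: n_def intro: Inf_nat_def1 cInf_lower)
          then have "accepts G (insert n s) D" using I by (auto simp: K_def)
          moreover have "I - {n} \<subseteq> D" "infinite (I - {n})" "below (insert n s) (I - {n})"
            using I n s by (auto simp: K_def order.strict_iff_order)
          ultimately obtain t where "t \<in> G" "init_seg t (insert n s \<union> (I - {n}))"
            unfolding accepts_def by meson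
          moreover have "insert n s \<union> (I - {n}) = s \<union> I" using n by auto
          ultimately show "\<exists>t\<in>G. init_seg t (s \<union> I)" by auto
        qed
        moreover have "K \<subseteq> D" using s by (auto simp: K_def)
        ultimately have "finite K"
          using D(3)[of s] s False unfolding decides_def by blast
        then have "infinite (N - K)" using s by simp
        moreover have "P s (N - K)" by (auto simp: P_def K_def)
        ultimately show ?thesis by blast
      qed
    next
      fix s N N' assume "P s N" "{n\<in>N'. below s {n}} \<subseteq> N"
      then show "P s N'" unfolding P_def by blast
    qed (use D in auto)
    have rej: "\<not> accepts G s D" if "finite s" "s \<subseteq> L" for s
      using that
    proof (induction s rule: finite_linorder_max_induct)
      case (insert b A)
      then show ?case using L(3)[of A] by (auto simp: P_def)
    qed (use False in simp)
    have "s \<notin> G" if "finite s" "s \<subseteq> L" for s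
      using rej[OF that] init_seg_Un_below unfolding accepts_def by blast
    then have "Fpow L \<inter> G = {}" by (auto simp: Fpow_def)
    then show ?thesis using that(1)[of L] L D by auto
  qed
qed


section \<open>Fronts\<close>

text \<open>These are the fronts on the positive integers. Uniqueness amounts to thinness: two
  members, one an initial segment of the other, are both initial segments of some infinite
  set.\<close>

definition front :: "nat set set \<Rightarrow> bool" where
  "front B \<longleftrightarrow> B \<subseteq> Fpow {1..} \<and> (\<forall>I\<subseteq>{1..}. infinite I \<longrightarrow> (\<exists>!s. s \<in> B \<and> init_seg s I))"

lemma init_seg_below: "init_seg s I \<Longrightarrow> below s (I - s)"
  unfolding init_seg_def by (metis Diff_iff linorder_neqE_nat)

lemma init_seg_Diff:
  assumes "init_seg t I" "init_seg s (I - t)"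
  shows "init_seg (t \<union> s) I"
  using assms unfolding init_seg_def by blast

lemma init_seg_Min:
  fixes I :: "nat set"
  assumes "init_seg s I" "finite s" "s \<noteq> {}"
  shows "Min s = Inf I"
proof (rule antisym)
  have s: "s \<subseteq> I" "Min s \<in> s" using assms by (auto simp: init_seg_def)
  then have "Inf I \<in> I" by (intro Inf_nat_def1) auto
  then have "Inf I \<in> s \<or> Min s \<le> Inf I"
    using assms(1) s(2) unfolding init_seg_def by (metis not_le)
  then show "Min s \<le> Inf I" using assms(2) by auto
  show "Inf I \<le> Min s" using s by (intro wellorder_Inf_le1) auto
qed

text \<open>Rules (3) and (4) of the Schreier system are both of this form.\<close>

lemma front_diagonal:
  assumes C: "\<And>k. 1 \<le> k \<Longrightarrow> front (C k)" and ne: "\<And>k. 1 \<le> k \<Longrightarrow> {} \<notin> C k"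
  shows "front {u. u \<noteq> {} \<and> finite u \<and> u \<subseteq> {1..} \<and> u \<in> C (Min u)}" (is "front ?D")
  unfolding front_def
proof (intro conjI allI impI)
  show "?D \<subseteq> Fpow {1..}" by (auto simp: Fpow_def)
  fix I :: "nat set" assume I: "I \<subseteq> {1..}" "infinite I"
  then have k: "1 \<le> Inf I" using Inf_nat_def1[of I] by force
  \<comment> \<open>All nonempty finite initial segments of \<open>I\<close> have minimum
    \<open>Inf I\<close>, so only the single front \<open>C (Inf I)\<close> is relevant to
    \<open>I\<close>.\<close>
  have "u \<in> ?D \<and> init_seg u I \<longleftrightarrow> u \<in> C (Inf I) \<and> init_seg u I" for u
  proof (cases "u \<noteq> {} \<and> finite u \<and> init_seg u I")
    case True
    then show ?thesis using C[OF k] init_seg_Min[of u I] by (auto simp: front_def Fpow_def subset_iff)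
  next
    case False
    then show ?thesis using C[OF k] ne[OF k] by (auto simp: front_def Fpow_def)
  qed
  then show "\<exists>!s. s \<in> ?D \<and> init_seg s I"
    using C[OF k] I by (simp add: front_def)
qed

text \<open>Unlike \<open>before\<close>, the relation \<open>below\<close> allows an empty left
  operand, so the recursion can start from no blocks at all.\<close>

fun blocks :: "nat set set \<Rightarrow> nat \<Rightarrow> nat set set" where
  "blocks B 0 = {{}}"
| "blocks B (Suc k) = {t \<union> s |t s. t \<in> blocks B k \<and> s \<in> B \<and> below t s}"

text \<open>Given \<open>I\<close>, the first \<open>k\<close> blocks form a unique initial segment
  \<open>t\<close>, and the last block is the unique member of \<open>B\<close> that begins
  \<open>I - t\<close>.\<close>

lemma front_blocks:
  assumes B: "front B"
  shows "front (blocks B k)"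
proof (induction k)
  case 0
  then show ?case by (auto simp: front_def Fpow_def init_seg_def)
next
  case (Suc k)
  show ?case
    unfolding front_def
  proof (intro conjI allI impI)
    show "blocks B (Suc k) \<subseteq> Fpow {1..}"
      using Suc B by (auto simp: front_def Fpow_def subset_iff)
    fix I :: "nat set" assume I: "I \<subseteq> {1..}" "infinite I"
    obtain t where t: "t \<in> blocks B k" "init_seg t I"
      and t_uniq: "\<And>t'. t' \<in> blocks B k \<Longrightarrow> init_seg t' I \<Longrightarrow> t' = t"
      using Suc I unfolding front_def by metis
    have "finite t" using Suc t by (auto simp: front_def Fpow_def)
    then have J: "I - t \<subseteq> {1..}" "infinite (I - t)" using I by auto
    obtain s where s: "s \<in> B" "init_seg s (I - t)"
      and s_uniq: "\<And>s'. s' \<in> B \<Longrightarrow> init_seg s' (I - t) \<Longrightarrow> s' = s"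
      using B J unfolding front_def by metis
    show "\<exists>!u. u \<in> blocks B (Suc k) \<and> init_seg u I"
    proof (intro ex1I[of _ "t \<union> s"] conjI)
      have "below t s"
        using init_seg_below[OF t(2)] s(2) unfolding init_seg_def by blast
      then show "t \<union> s \<in> blocks B (Suc k)" using t s by auto
      show "init_seg (t \<union> s) I" using t s by (intro init_seg_Diff)
      fix u assume u: "u \<in> blocks B (Suc k) \<and> init_seg u I"
      then obtain t' s' where *: "u = t' \<union> s'" "t' \<in> blocks B k" "s' \<in> B" "below t' s'"
        by auto
      have "init_seg t' I" using u * init_seg_Un_below init_seg_trans by blast
      then have "t' = t" using * t_uniq by blast
      moreover have "init_seg s' (I - t')"
        unfolding init_seg_def
      proof (intro conjI ballI impI)
        show "s' \<subseteq> I - t'" using u * unfolding init_seg_def by auto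
        fix x y assume "x \<in> s'" "y \<in> I - t'" "y < x"
        then show "y \<in> s'" using u *(1) unfolding init_seg_def by blast
      qed
      ultimately show "u = t \<union> s" using * s_uniq by blast
    qed
  qed
qed

lemma blocks_nonempty: "{} \<notin> B \<Longrightarrow> 1 \<le> k \<Longrightarrow> {} \<notin> blocks B k"
  by (cases k) auto

text \<open>Further blocks can always be taken from the part of \<open>L\<close> above what is
  already there, since \<open>B\<close> is a front.\<close>

lemma blocks_extend:
  assumes B: "front B" and t: "t \<in> blocks B k" "k \<le> l" and L: "infinite L" "L \<subseteq> {1..}"
  shows "\<exists>u\<in>blocks B l. init_seg t u \<and> u \<subseteq> t \<union> L"
  using t(2)
proof (induction l rule: dec_induct)
  case base
  then show ?case using t init_seg_refl by auto
next
  case (step l)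
  then obtain u where u: "u \<in> blocks B l" "init_seg t u" "u \<subseteq> t \<union> L" by auto
  then have fin: "finite u" using front_blocks[OF B, of l] by (auto simp: front_def Fpow_def)
  obtain s where s: "s \<in> B" "init_seg s {n\<in>L. below u {n}}"
    using B L infinite_above[OF L(1) fin] unfolding front_def
    by (metis (no_types, lifting) mem_Collect_eq subsetD subsetI)
  then have "s \<subseteq> L" "below u s" unfolding init_seg_def by blast+
  moreover from this have "init_seg t (u \<union> s)"
    using u init_seg_Un_below init_seg_trans by blast
  ultimately show ?case using u s by (intro bexI[of _ "u \<union> s"]) auto
qed

text \<open>The Schreier rules order only neighbouring sets. Nonempty intermediate sets carry the
  order to all pairs, and finiteness makes \<open>Max\<close> and \<open>Min\<close> true
  bounds.\<close>

lemma before_chain: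
  assumes "\<forall>i\<in>{1..<k}. s i \<lless> s (i + 1)" "\<forall>i\<in>{1..k}. finite (s i) \<and> s i \<noteq> {}"
    and "1 \<le> i" "Suc i \<le> j" "j \<le> k"
  shows "below (s i) (s j)"
proof -
  have adjacent: "below (s m) (s (Suc m))" if "1 \<le> m" "m < k" for m
  proof -
    have "s m \<lless> s (m + 1)" "finite (s m)" "finite (s (m + 1))" using assms(1,2) that by auto
    then show ?thesis
      by (auto simp: before_def) (metis Max_ge Min_le le_less_trans less_le_trans)
  qed
  show ?thesis
    using assms(4,5)
  proof (induction j rule: dec_induct)
    case base
    then show ?case using adjacent assms(3) by simp
  next
    case (step j)
    then have j: "1 \<le> j" "j < k" using assms(3) by simp_all
    then have "below (s j) (s (Suc j))" by (rule adjacent)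
    moreover have "s j \<noteq> {}" using assms(2) j by simp
    moreover have "below (s i) (s j)" using step.IH j by simp
    ultimately show ?case by (meson all_not_in_conv less_trans)
  qed
qed

text \<open>The recursion suits induction, while the indexed union is the form of rule (3). Since
  members of \<open>B\<close> are nonempty, \<open>below\<close> and \<open>before\<close> agree on
  them.\<close>

lemma blocks_eq:
  assumes B: "front B" "{} \<notin> B"
  shows "u \<in> blocks B k \<longleftrightarrow>
    (\<exists>s. u = (\<Union>i\<in>{1..k}. s i) \<and> (\<forall>i\<in>{1..<k}. s i \<lless> s (i + 1)) \<and> (\<forall>i\<in>{1..k}. s i \<in> B))"
proof (induction k arbitrary: u)
  case (Suc k)
  have fin: "finite s" "s \<noteq> {}" if "s \<in> B" for s
    using that B by (auto simp: front_def Fpow_def)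
  show ?case (is "_ \<longleftrightarrow> ?R")
  proof
    assume "u \<in> blocks B (Suc k)"
    then obtain t r where tr: "u = t \<union> r" "t \<in> blocks B k" "r \<in> B" "below t r" by auto
    from tr(2) Suc.IH[of t] obtain s where s: "t = (\<Union>i\<in>{1..k}. s i)" "\<forall>i\<in>{1..<k}. s i \<lless> s (i + 1)"
      "\<forall>i\<in>{1..k}. s i \<in> B" by blast
    define s' where "s' = s(Suc k := r)"
    have "s' i \<lless> s' (i + 1)" if "i \<in> {1..<Suc k}" for i
    proof (cases "i = k")
      case True
      then have "s k \<in> B" using that s by auto
      moreover have "below (s k) r" using True that s(1) tr(4) by fastforce
      ultimately show ?thesis
        using True tr(3) fin by (auto simp: s'_def before_def)
    next
      case False
      then show ?thesis using that s by (auto simp: s'_def)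
    qed
    moreover have "u = (\<Union>i\<in>{1..Suc k}. s' i)" "\<forall>i\<in>{1..Suc k}. s' i \<in> B"
      using s tr by (auto simp: s'_def atLeastAtMostSuc_conv)
    ultimately show ?R by blast
  next
    assume ?R
    then obtain s where s: "u = (\<Union>i\<in>{1..Suc k}. s i)" "\<forall>i\<in>{1..<Suc k}. s i \<lless> s (i + 1)"
      "\<forall>i\<in>{1..Suc k}. s i \<in> B" by blast
    define t where "t = (\<Union>i\<in>{1..k}. s i)"
    have "t \<in> blocks B k" unfolding Suc t_def using s by (intro exI[of _ s]) auto
    moreover have "below (s i) (s (Suc k))" if "i \<in> {1..k}" for i
      by (rule before_chain[OF s(2)]) (use s fin that in auto)
    then have "below t (s (Suc k))" by (fastforce simp: t_def)
    moreover have "u = t \<union> s (Suc k)" using s by (auto simp: t_def atLeastAtMostSuc_conv)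
    moreover have "s (Suc k) \<in> B" using s(3) by simp
    ultimately show "u \<in> blocks B (Suc k)" unfolding blocks.simps by blast
  qed
qed auto


section \<open>The Schreier families of indecomposable index\<close>

lemma thin_family_one: "thin_family lam 1 = {{n} |n. 1 \<le> n}"
proof -
  have "thin_family lam 1 = {{n} \<union> s |n s. 1 \<le> n \<and> {n} \<lless> s \<and> s = {}}"
    using thin_family_succ[of lam 0] unfolding thin_family_zero by simp
  then show ?thesis by (simp add: before_def)
qed

text \<open>Rule (3) counts blocks by the minimum of the first one. The first block is an initial
  segment of the union, so this is also the minimum of the union, and the family becomes a diagonal
  one as in \<open>front_diagonal\<close>.\<close>

lemma thin_family_omega_succ_blocks:
  assumes "front (thin_family lam (omega_pow b))" (is "front ?B") "{} \<notin> thin_family lam (omega_pow b)"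
  shows "thin_family lam (omega_pow (b + 1)) =
    {u. u \<noteq> {} \<and> finite u \<and> u \<subseteq> {1..} \<and> u \<in> blocks ?B (Min u)}"
proof -
  have fin: "finite u" "u \<subseteq> {1..}" if "u \<in> blocks ?B k" for u k
    using front_blocks[OF assms(1), of k] that by (auto simp: front_def Fpow_def)
  have finB: "finite r" "r \<noteq> {}" "r \<subseteq> {1..}" if "r \<in> ?B" for r
    using that assms by (auto simp: front_def Fpow_def)
  have Min_eq: "Min (\<Union>i\<in>{1..n}. s i) = Min (s 1)" (is "Min ?u = _")
    if "1 \<le> n" "\<forall>i\<in>{1..<n}. s i \<lless> s (i + 1)" "\<forall>i\<in>{1..n}. s i \<in> ?B" for n :: nat and s
  proof -
    have "below (s 1) (s i)" if "i \<in> {1..n} - {1}" for i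
      by (rule before_chain[OF \<open>\<forall>i\<in>{1..<n}. s i \<lless> s (i + 1)\<close>])
        (use finB \<open>\<forall>i\<in>{1..n}. s i \<in> ?B\<close> that in auto)
    then have "below (s 1) (\<Union>i\<in>{1..n} - {1}. s i)" by auto
    then have "init_seg (s 1) (s 1 \<union> (\<Union>i\<in>{1..n} - {1}. s i))" by (rule init_seg_Un_below)
    also have "s 1 \<union> (\<Union>i\<in>{1..n} - {1}. s i) = ?u" using \<open>1 \<le> n\<close> by auto
    finally have "Min (s 1) = Inf ?u"
      using finB that by (intro init_seg_Min) auto
    moreover have "finite ?u" "?u \<noteq> {}" using that finB by fastforce+
    ultimately show ?thesis by (simp add: cInf_eq_Min)
  qed
  show ?thesis
  proof (intro set_eqI iffI)
    fix u assume "u \<in> thin_family lam (omega_pow (b + 1))"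
    then obtain n s where s: "u = (\<Union>i\<in>{1..n}. s i)" "1 \<le> n" "n = Min (s 1)"
      "\<forall>i\<in>{1..<n}. s i \<lless> s (i + 1)" "\<forall>i\<in>{1..n}. s i \<in> ?B"
      unfolding thin_family_omega_succ by blast
    then have "u \<in> blocks ?B (Min u)"
      using Min_eq[OF s(2,4,5)] blocks_eq[OF assms, of u n] by auto
    moreover have "s 1 \<in> ?B" "s 1 \<subseteq> u" using s(1,2,5) by auto
    then have "u \<noteq> {}" using finB(2) by blast
    ultimately show "u \<in> {u. u \<noteq> {} \<and> finite u \<and> u \<subseteq> {1..} \<and> u \<in> blocks ?B (Min u)}"
      using fin by blast
  next
    fix u assume u: "u \<in> {u. u \<noteq> {} \<and> finite u \<and> u \<subseteq> {1..} \<and> u \<in> blocks ?B (Min u)}"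
    then have "u \<in> blocks ?B (Min u)" by blast
    then obtain s where s: "u = (\<Union>i\<in>{1..Min u}. s i)"
      "\<forall>i\<in>{1..<Min u}. s i \<lless> s (i + 1)" "\<forall>i\<in>{1..Min u}. s i \<in> ?B"
      unfolding blocks_eq[OF assms] by (elim exE conjE)
    have "Min u \<in> {1..}" using u Min_in[of u] by blast
    then have one: "1 \<le> Min u" by simp
    have "Min u = Min (s 1)"
      using arg_cong[OF s(1), of Min] Min_eq[OF one s(2,3)] by (rule trans)
    then show "u \<in> thin_family lam (omega_pow (b + 1))"
      unfolding thin_family_omega_succ
      by (intro CollectI exI[of _ "Min u"] exI[of _ s] conjI one s)
  qed
qed

lemma schreier_finite: "schreier lam x s \<Longrightarrow> finite s \<and> s \<subseteq> {1..}"
proof (induction rule: schreier.induct)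
  case (omega_succ n s b)
  then have "finite (s i) \<and> s i \<subseteq> {1..}" if "i \<in> {1..n}" for i
    using that by blast
  then show ?case by (simp add: UN_subset_iff)
next
  case (sum x a p m s t)
  then have "finite (t i) \<and> t i \<subseteq> {1..}" if "i \<le> m" for i
    using that sum(7-10) by (simp add: UN_subset_iff)
  then show ?case by (simp add: UN_subset_iff)
qed simp_all

text \<open>Induction on the exponent, with \<open>front_diagonal\<close> at successors and limits.
  Absence of the empty set is carried along because the diagonal construction reads off a
  minimum.\<close>

lemma front_omega_pow:
  assumes lam: "fundamental_sequences lam"
  shows "front (thin_family lam (omega_pow a)) \<and> {} \<notin> thin_family lam (omega_pow a)"
proof (induction a rule: less_induct)
  case (less a)
  consider "a = 0" | b where "a = b + 1" | "limit_ord a"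
    unfolding limit_ord_def succ_ord_def by blast
  then show ?case
  proof cases
    case 1
    have "\<exists>!s. s \<in> {{n} |n. 1 \<le> n} \<and> init_seg s I" if I: "I \<subseteq> {1..}" "infinite I" for I
    proof (rule ex1I[of _ "{Inf I}"])
      have "Inf I \<in> I" using I by (intro Inf_nat_def1) auto
      moreover have "Inf I \<le> n" if "n \<in> I" for n using that by (simp add: cInf_lower)
      ultimately show "{Inf I} \<in> {{n} |n. 1 \<le> n} \<and> init_seg {Inf I} I"
        using I by (force simp: init_seg_def)
    qed (use init_seg_Min in fastforce)
    then show ?thesis
      unfolding 1 omega_pow_zero thin_family_one by (auto simp: front_def Fpow_def)
  next
    case (2 b)
    then have B: "front (thin_family lam (omega_pow b))" "{} \<notin> thin_family lam (omega_pow b)"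
      using less[of b] less_add_one_omega1 by auto
    show ?thesis
      unfolding 2 thin_family_omega_succ_blocks[OF B]
      using front_diagonal[of "blocks (thin_family lam (omega_pow b))"]
        front_blocks[OF B(1)] blocks_nonempty[OF B(2)] by simp
  next
    case 3
    define C where "C k = thin_family lam (omega_pow (lam a k))" for k
    have C: "front (C k)" "{} \<notin> C k" if "1 \<le> k" for k
      using less[of "lam a k"] 3 lam that by (auto simp: fundamental_sequences_def C_def)
    have "finite u \<and> u \<subseteq> {1..}" if "u \<noteq> {}" "u \<in> C (Min u)" for u
      using that(2) schreier_finite[of lam _ u] by (simp add: C_def thin_family_def)
    then have "thin_family lam (omega_pow a) = {u. u \<noteq> {} \<and> finite u \<and> u \<subseteq> {1..} \<and> u \<in> C (Min u)}"
      unfolding thin_family_omega_limit[OF 3] by (auto simp: C_def)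
    then show ?thesis using front_diagonal[of C] C by simp
  qed
qed

section \<open>Splitting off the first block\<close>

text \<open>The restriction \<open>n \<ge> 2\<close> makes room for at least two blocks in a set with minimum \<open>n\<close>.\<close>

lemma thin_family_omega_succ_split:
  assumes lam: "fundamental_sequences lam" and L: "infinite L" "L \<subseteq> {1..}" and n: "n \<in> L" "2 \<le> n"
  obtains v where "v \<in> thin_family lam (omega_pow b)" "v \<subseteq> L"
    "\<forall>t\<in>thin_family lam (omega_pow b). t \<subseteq> L \<and> below v t \<longrightarrow>
       (\<exists>u\<in>thin_family lam (omega_pow (b + 1)). u \<subseteq> L \<and> Min u = n \<and> init_seg (v \<union> t) u)"
proof -
  let ?B = "thin_family lam (omega_pow b)"
  have B: "front ?B" "{} \<notin> ?B" using front_omega_pow[OF lam] by blast+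
  \<comment> \<open>Starting at \<open>n\<close> forces the first block \<open>v\<close> to have
    minimum \<open>n\<close>, hence \<open>u\<close> will consist of exactly \<open>n\<close>
    blocks.\<close>
  define I where "I = L - {..<n}"
  have I: "infinite I" "I \<subseteq> L" using L by (auto simp: I_def)
  have "Inf I = n"
    using n by (intro cInf_eq_minimum) (auto simp: I_def)
  have "I \<subseteq> {1..}" using I L by blast
  then obtain v where v: "v \<in> ?B" "init_seg v I"
    using B(1) I unfolding front_def by metis
  then have v': "finite v" "v \<noteq> {}" "v \<subseteq> L"
    using B I by (auto simp: front_def Fpow_def init_seg_def)
  then have "Min v = n"
    using init_seg_Min v \<open>Inf I = n\<close> by simp
  show ?thesis
  proof (rule that[OF v(1) v'(3)], intro ballI impI)
    fix t assume "t \<in> ?B" "t \<subseteq> L \<and> below v t"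
    then have t: "t \<in> ?B" "t \<subseteq> L" "below v t" by blast+
    \<comment> \<open>Two blocks \<open>v\<close> and \<open>t\<close> are in place; as
      \<open>n\<close> is at least 2, they can be completed to \<open>n\<close> blocks inside
      \<open>L\<close>.\<close>
    have "v \<in> blocks ?B (Suc 0)" using v by auto
    then have "v \<union> t \<in> blocks ?B (Suc (Suc 0))" using t by (subst blocks.simps) blast
    then obtain u where u: "u \<in> blocks ?B n" "init_seg (v \<union> t) u" "u \<subseteq> v \<union> t \<union> L"
      using blocks_extend[OF B(1), of "v \<union> t" "Suc (Suc 0)" n L] n L by auto
    have "finite u" "u \<subseteq> {1..}"
      using u(1) front_blocks[OF B(1), of n] by (auto simp: front_def Fpow_def)
    moreover have "init_seg v u"
      using init_seg_Un_below[OF t(3)] u(2) by (rule init_seg_trans)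
    moreover from this have "u \<noteq> {}" using v' by (auto simp: init_seg_def)
    ultimately have "Min u = n"
      using init_seg_Min[of v u] v' \<open>Min v = n\<close> by (simp add: cInf_eq_Min)
    then show "\<exists>u\<in>thin_family lam (omega_pow (b + 1)). u \<subseteq> L \<and> Min u = n \<and> init_seg (v \<union> t) u"
      unfolding thin_family_omega_succ_blocks[OF B]
      using u v' t \<open>finite u\<close> \<open>u \<subseteq> {1..}\<close> \<open>u \<noteq> {}\<close> by (intro bexI[of _ u]) auto
  qed
qed

text \<open>At a successor \<open>a\<close> the index \<open>b\<close> is the predecessor. At a
  limit, a large \<open>n\<close> in \<open>L\<close> is chosen as minimum: rule (4) then refers to
  \<open>lam a n\<close>, which is a successor \<open>b + 1\<close> above \<open>d\<close>. The
  bound \<open>d \<le> b\<close> limits the loss of index.\<close>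

lemma thin_family_omega_split:
  assumes lam: "fundamental_sequences lam" and L: "infinite L" "L \<subseteq> {1..}" and "d < a"
  obtains b v where "d \<le> b" "v \<in> thin_family lam (omega_pow b)" "v \<subseteq> L"
    "\<forall>t\<in>thin_family lam (omega_pow b). t \<subseteq> L \<and> below v t \<longrightarrow>
       (\<exists>u\<in>thin_family lam (omega_pow a). u \<subseteq> L \<and> init_seg (v \<union> t) u)"
proof -
  have big: "\<exists>n\<in>L. m \<le> n" for m
    using L(1) by (auto simp: infinite_nat_iff_unbounded_le)
  consider "a = 0" | b where "a = b + 1" | "limit_ord a"
    unfolding limit_ord_def succ_ord_def by blast
  then show ?thesis
  proof cases
    case 1
    then show ?thesis using \<open>d < a\<close> by simp
  next
    case (2 b)
    obtain n where n: "n \<in> L" "2 \<le> n" using big by blast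
    obtain v where v: "v \<in> thin_family lam (omega_pow b)" "v \<subseteq> L"
      "\<forall>t\<in>thin_family lam (omega_pow b). t \<subseteq> L \<and> below v t \<longrightarrow>
         (\<exists>u\<in>thin_family lam (omega_pow (b + 1)). u \<subseteq> L \<and> Min u = n \<and> init_seg (v \<union> t) u)"
      by (rule thin_family_omega_succ_split[OF lam L n])
    have "\<exists>u\<in>thin_family lam (omega_pow a). u \<subseteq> L \<and> init_seg (v \<union> t) u"
      if "t \<in> thin_family lam (omega_pow b)" "t \<subseteq> L" "below v t" for t
    proof -
      have "\<exists>u\<in>thin_family lam (omega_pow (b + 1)). u \<subseteq> L \<and> Min u = n \<and> init_seg (v \<union> t) u"
        using bspec[OF v(3) that(1)] that(2,3) by simp
      then show ?thesis unfolding 2 by blast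
    qed
    moreover have "d \<le> b" using \<open>d < a\<close> 2 by (simp add: less_add_one_iff_omega1)
    ultimately show ?thesis using v(1,2) by (intro that[of b v]) blast+
  next
    case 3
    have seq: "strict_mono_on {1..} (lam a)" "\<And>n. 1 \<le> n \<Longrightarrow> succ_ord (lam a n)"
      "(SUP n\<in>{1..}. lam a n) = a"
      using lam 3 by (auto simp: fundamental_sequences_def)
    have "d < (SUP n\<in>{1..}. lam a n)" using \<open>d < a\<close> seq(3) by simp
    then obtain m where m: "1 \<le> m" "d < lam a m"
      by (subst (asm) less_cSUP_iff) (auto intro: bdd_above_omega1)
    \<comment> \<open>The bound 2 leaves room for two blocks; the bound \<open>m\<close> keeps
      \<open>lam a n\<close> above \<open>d\<close>.\<close>
    obtain n where n: "n \<in> L" "max 2 m \<le> n" using big by blast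
    then have "lam a m \<le> lam a n"
      using strict_mono_onD[OF seq(1), of m n] m by (cases "m = n") auto
    moreover obtain b where b: "lam a n = b + 1"
      using seq(2)[of n] n by (auto simp: succ_ord_def)
    ultimately have "d < b + 1" using m by simp
    then have "d \<le> b" by (simp add: less_add_one_iff_omega1)
    have "2 \<le> n" using n(2) by simp
    obtain v where v: "v \<in> thin_family lam (omega_pow b)" "v \<subseteq> L"
      "\<forall>t\<in>thin_family lam (omega_pow b). t \<subseteq> L \<and> below v t \<longrightarrow>
         (\<exists>u\<in>thin_family lam (omega_pow (b + 1)). u \<subseteq> L \<and> Min u = n \<and> init_seg (v \<union> t) u)"
      by (rule thin_family_omega_succ_split[OF lam L n(1) \<open>2 \<le> n\<close>])
    have ne: "{} \<notin> thin_family lam (omega_pow (b + 1))"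
      using front_omega_pow[OF lam] by blast
    have "\<exists>u\<in>thin_family lam (omega_pow a). u \<subseteq> L \<and> init_seg (v \<union> t) u"
      if "t \<in> thin_family lam (omega_pow b)" "t \<subseteq> L" "below v t" for t
    proof -
      have "\<exists>u\<in>thin_family lam (omega_pow (b + 1)). u \<subseteq> L \<and> Min u = n \<and> init_seg (v \<union> t) u"
        using bspec[OF v(3) that(1)] that(2,3) by simp
      then obtain u where u: "u \<in> thin_family lam (omega_pow (b + 1))" "u \<subseteq> L" "Min u = n"
        "init_seg (v \<union> t) u"
        by blast
      \<comment> \<open>\<open>Min u = n\<close> makes rule (4) select the index
        \<open>lam a n\<close>, that is, \<open>b + 1\<close>.\<close>
      then have "u \<in> thin_family lam (omega_pow a)"
        unfolding thin_family_omega_limit[OF 3] using ne b by auto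
      then show ?thesis using u by blast
    qed
    then show ?thesis using \<open>d \<le> b\<close> v(1,2) by (intro that[of b v]) blast+
  qed
qed


section \<open>Trees without infinite branches\<close>

lemma is_tree_init_seg: "is_tree F \<Longrightarrow> s \<in> F \<Longrightarrow> init_seg t s \<Longrightarrow> t \<in> F"
proof -
  assume F: "is_tree F" "s \<in> F" "init_seg t s"
  then have "s \<in> Fpow {1..}" by (auto simp: is_tree_def)
  then have "t \<in> Fpow {1..}"
    using F(3) finite_subset[of t s] by (auto simp: Fpow_def init_seg_def)
  then have "t \<in> star F" using F by (auto simp: star_def)
  then show "t \<in> F" using F by (simp add: is_tree_def)
qed

text \<open>The cardinalities along the chain grow without bound. A finite part of the union is
  contained in some \<open>f n\<close>, and there it is still an initial segment.\<close>

lemma init_seg_chain_infinite_branch: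
  assumes fin: "\<And>n. finite (f n)" and chain: "\<And>n. init_seg (f n) (f (Suc n))" "\<And>n. f n \<noteq> f (Suc n)"
  shows "infinite (\<Union>n. f n)"
    and "finite t \<Longrightarrow> init_seg t (\<Union>n. f n) \<Longrightarrow> \<exists>n. init_seg t (f n)"
proof -
  have sub: "f n \<subset> f (Suc n)" for n
    using chain[of n] by (auto simp: init_seg_def)
  show "infinite (\<Union>n. f n)"
  proof
    assume I: "finite (\<Union>n. f n)"
    have "n \<le> card (f n)" for n
    proof (induction n)
      case (Suc n)
      then show ?case using psubset_card_mono[OF fin sub, of n] by linarith
    qed simp
    moreover have "card (f n) \<le> card (\<Union>n. f n)" for n
      using I by (intro card_mono) auto
    ultimately show False
      by (metis not_less_eq_eq order_trans order_refl)
  qed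
  assume t: "finite t" "init_seg t (\<Union>n. f n)"
  have mono: "f m \<subseteq> f n" if "m \<le> n" for m n
    using lift_Suc_mono_le[of f m n] sub that by blast
  have "\<exists>n. t \<subseteq> f n"
  proof -
    obtain k where k: "\<And>x. x \<in> t \<Longrightarrow> x \<in> f (k x)"
      using t(2) unfolding init_seg_def by (metis UN_iff subsetD)
    have "t \<subseteq> f (Max (k ` t))"
    proof
      fix x assume "x \<in> t"
      then have "k x \<le> Max (k ` t)" using t(1) by simp
      then show "x \<in> f (Max (k ` t))" using k[OF \<open>x \<in> t\<close>] mono by blast
    qed
    then show ?thesis by blast
  qed
  then obtain n where "t \<subseteq> f n" by blast
  then have "init_seg t (f n)"
    using t(2) unfolding init_seg_def by (meson UN_I UNIV_I)
  then show "\<exists>n. init_seg t (f n)" by blast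
qed

text \<open>By contradiction, with the notion \<open>good\<close> below: the empty set is good, good
  sets belong to \<open>F\<close>, and each has a proper good end-extension. The union of a chain of
  these is an infinite subset of \<open>M\<close> whose finite initial segments all lie in
  \<open>F\<close>, against \<open>wf\<close>.\<close>

lemma tree_omits_thin_sets:
  assumes lam: "fundamental_sequences lam" and F: "is_tree F" and M: "M \<subseteq> {1..}"
    and wf: "\<And>I. I \<subseteq> M \<Longrightarrow> infinite I \<Longrightarrow> \<exists>t. finite t \<and> t \<notin> F \<and> init_seg t I"
  obtains a where
    "\<And>L. L \<subseteq> M \<Longrightarrow> infinite L \<Longrightarrow> \<exists>t\<in>thin_family lam (omega_pow a). t \<subseteq> L \<and> t \<notin> F"
proof (rule ccontr)
  assume "\<not> thesis"
  then have neg: "\<exists>L\<subseteq>M. infinite L \<and> (\<forall>t\<in>thin_family lam (omega_pow a). t \<subseteq> L \<longrightarrow> t \<in> F)" for a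
    using that by metis
  define witness where "witness s a \<longleftrightarrow> (\<exists>L\<subseteq>M. infinite L \<and> below s L \<and>
    (\<forall>t\<in>thin_family lam (omega_pow a). t \<subseteq> L \<longrightarrow> s \<union> t \<in> F))" for s a
  \<comment> \<open>Peeling off one block lowers the index \<open>a\<close>, possibly to a limit, so unboundedly many
    indices are required rather than any particular kind.\<close>
  define good where "good s \<longleftrightarrow> finite s \<and> s \<subseteq> M \<and> (\<forall>d. \<exists>a\<ge>d. witness s a)" for s
  have "good {}"
    using neg unfolding good_def witness_def by auto
  have front: "front (thin_family lam (omega_pow a))" "{} \<notin> thin_family lam (omega_pow a)" for a
    using front_omega_pow[OF lam] by blast+
  have good_F: "s \<in> F" if good: "good s" for s
  proof -
    obtain a where "witness s a" using good unfolding good_def by blast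
    then obtain L where L: "L \<subseteq> M" "infinite L" "below s L"
      "\<forall>t\<in>thin_family lam (omega_pow a). t \<subseteq> L \<longrightarrow> s \<union> t \<in> F"
      unfolding witness_def by blast
    have "L \<subseteq> {1..}" using L M by blast
    then obtain t where t: "t \<in> thin_family lam (omega_pow a)" "init_seg t L"
      using L(2) front(1)[of a] unfolding front_def by metis
    then have "t \<subseteq> L" by (simp add: init_seg_def)
    then have "init_seg s (s \<union> t)" using L(3) by (intro init_seg_Un_below) blast
    moreover have "s \<union> t \<in> F" using L(4) t(1) \<open>t \<subseteq> L\<close> by blast
    ultimately show ?thesis using is_tree_init_seg[OF F] by blast
  qed
  have step: "\<exists>s'. good s' \<and> init_seg s s' \<and> s \<noteq> s'" if s: "good s" for s
  proof (rule ccontr)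
    assume no: "\<nexists>s'. good s' \<and> init_seg s s' \<and> s \<noteq> s'"
    define V where "V = {v \<in> Fpow M. v \<noteq> {} \<and> below s v}"
    have "\<exists>d. \<forall>a\<ge>d. \<not> witness (s \<union> v) a" if "v \<in> V" for v
    proof -
      have "init_seg s (s \<union> v)" using that by (intro init_seg_Un_below) (auto simp: V_def)
      moreover have "s \<noteq> s \<union> v" using that by (auto simp: V_def)
      ultimately have "\<not> good (s \<union> v)" using no by blast
      then show ?thesis using that s by (auto simp: good_def V_def Fpow_def)
    qed
    \<comment> \<open>Beyond \<open>D v\<close> no index has a witness for
      \<open>s \<union> v\<close>. There are countably many candidates \<open>v\<close>, so one
      countable ordinal \<open>z\<close> exceeds all these bounds.\<close>
    then obtain D where D: "\<And>v a. v \<in> V \<Longrightarrow> D v \<le> a \<Longrightarrow> \<not> witness (s \<union> v) a" by metis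
    have "countable V"
      by (rule countable_subset[OF _ countable_Collect_finite]) (auto simp: V_def Fpow_def)
    then obtain z where z: "\<forall>x\<in>D ` V. x < z"
      using countable_bounded_omega1[of "D ` V"] by auto
    obtain a where a: "z + 1 \<le> a" "witness s a"
      using s unfolding good_def by blast
    then obtain L where L: "L \<subseteq> M" "infinite L" "below s L"
      "\<forall>t\<in>thin_family lam (omega_pow a). t \<subseteq> L \<longrightarrow> s \<union> t \<in> F"
      unfolding witness_def by blast
    have za: "z < a" using less_add_one_omega1 a(1) by (rule less_le_trans)
    have "L \<subseteq> {1..}" using L(1) M by blast
    \<comment> \<open>Splitting above \<open>z\<close> leaves an index \<open>b\<close> that is
      still at least \<open>z\<close>, hence beyond \<open>D v\<close> for whichever
      \<open>v\<close> turns up.\<close>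
    obtain b v where bv: "z \<le> b" "v \<in> thin_family lam (omega_pow b)" "v \<subseteq> L"
      "\<forall>t\<in>thin_family lam (omega_pow b). t \<subseteq> L \<and> below v t \<longrightarrow>
         (\<exists>u\<in>thin_family lam (omega_pow a). u \<subseteq> L \<and> init_seg (v \<union> t) u)"
      by (rule thin_family_omega_split[OF lam L(2) \<open>L \<subseteq> {1..}\<close> za])
    have v: "finite v" "v \<noteq> {}"
      using bv(2) front[of b] by (auto simp: front_def Fpow_def)
    then have "v \<in> V" using bv(3) L by (auto simp: V_def Fpow_def)
    define L' where "L' = {n\<in>L. below v {n}}"
    have "s \<union> v \<union> t \<in> F" if t: "t \<in> thin_family lam (omega_pow b)" "t \<subseteq> L'" for t
    proof -
      have "t \<subseteq> L" "below v t" using t(2) by (auto simp: L'_def)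
      then obtain u where u: "u \<in> thin_family lam (omega_pow a)" "u \<subseteq> L" "init_seg (v \<union> t) u"
        using bspec[OF bv(4) t(1)] by auto
      have "init_seg (s \<union> v \<union> t) (s \<union> u)"
        unfolding init_seg_def
      proof (intro conjI ballI impI)
        show "s \<union> v \<union> t \<subseteq> s \<union> u" using u(3) by (auto simp: init_seg_def)
        fix x y assume xy: "x \<in> s \<union> v \<union> t" "y \<in> s \<union> u" "y < x"
        show "y \<in> s \<union> v \<union> t"
        proof (cases "y \<in> s")
          case False
          then have "y \<in> u" using xy by simp
          \<comment> \<open>All of \<open>u\<close> lies above \<open>s\<close>, so an element
            larger than \<open>y\<close> comes from \<open>v \<union> t\<close>.\<close>
          then have "x \<notin> s" using L(3) u(2) xy(3) by (meson less_asym subsetD)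
          then show ?thesis using xy u(3) \<open>y \<in> u\<close> unfolding init_seg_def by blast
        qed simp
      qed
      moreover have "s \<union> u \<in> F" using L(4) u(1,2) by blast
      ultimately show ?thesis using is_tree_init_seg[OF F] by blast
    qed
    moreover have "infinite L'" "L' \<subseteq> M" "below (s \<union> v) L'"
      using infinite_above[OF L(2) v(1)] L by (auto simp: L'_def)
    ultimately have "witness (s \<union> v) b" unfolding witness_def by blast
    moreover have "D v \<le> b" using z \<open>v \<in> V\<close> bv(1) by (meson imageI less_imp_le less_le_trans)
    ultimately show False using D \<open>v \<in> V\<close> by blast
  qed
  obtain f where f: "\<And>n. good (f n)" "\<And>n. init_seg (f n) (f (Suc n))" "\<And>n. f n \<noteq> f (Suc n)"
    using dependent_nat_choice[of "\<lambda>_. good" "\<lambda>_ s s'. init_seg s s' \<and> s \<noteq> s'"] \<open>good {}\<close> step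
    by metis
  have fin: "finite (f n)" for n using f(1) by (simp add: good_def)
  note branch = init_seg_chain_infinite_branch[of f, OF fin f(2,3)]
  have "(\<Union>n. f n) \<subseteq> M" using f(1) by (auto simp: good_def)
  then obtain t where t: "finite t" "t \<notin> F" "init_seg t (\<Union>n. f n)"
    using wf branch(1) by blast
  then obtain n where "init_seg t (f n)" using branch(2) by blast
  then show False using t(2) good_F f(1) is_tree_init_seg[OF F] by blast
qed

theorem theoremC:
  fixes lam :: "omega1 \<Rightarrow> nat \<Rightarrow> omega1" and F :: "nat set set"
  assumes "fundamental_sequences lam" and "is_tree F"
  shows "\<exists>L. L \<subseteq> {1..} \<and> infinite L \<and>
           (Fpow L \<subseteq> F \<or>
            (\<exists>\<xi>\<^sub>0. \<forall>I. I \<subseteq> L \<and> infinite I \<longrightarrow>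
               (\<exists>s. init_seg s I \<and> s \<in> Fpow {1..} - F \<and> s \<in> thin_family lam \<xi>\<^sub>0 \<and>
                    (\<forall>t. init_seg t I \<and> t \<in> thin_family lam \<xi>\<^sub>0 \<longrightarrow> t = s))))"
proof -
  have "infinite ({1..} :: nat set)" by (simp add: infinite_Ici)
  then show ?thesis
  proof (cases rule: galvin[where G = "Fpow {1..} - F"])
    case (1 L)
    then have "Fpow L \<subseteq> F" by (auto simp: Fpow_def)
    then show ?thesis using 1 by blast
  next
    case (2 M)
    have "\<exists>t. finite t \<and> t \<notin> F \<and> init_seg t I" if "I \<subseteq> M" "infinite I" for I
      using 2(3)[OF that] by (auto simp: Fpow_def)
    then obtain a where a: "\<And>L. L \<subseteq> M \<Longrightarrow> infinite L \<Longrightarrow>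
        \<exists>t\<in>thin_family lam (omega_pow a). t \<subseteq> L \<and> t \<notin> F"
      using tree_omits_thin_sets[OF assms 2(1)] by blast
    let ?A = "thin_family lam (omega_pow a)"
    have A: "front ?A" using front_omega_pow[OF assms(1)] by blast
    show ?thesis
      using 2(2)
    proof (cases rule: galvin[where G = "?A - F"])
      \<comment> \<open>This alternative is excluded: by the choice of \<open>a\<close>, every
        infinite subset of \<open>M\<close> contains a member of the family outside
        \<open>F\<close>.\<close>
      case (1 L)
      then obtain t where "t \<in> ?A" "t \<subseteq> L" "t \<notin> F" using a by blast
      then have "t \<in> Fpow L \<inter> (?A - F)" using A by (auto simp: front_def Fpow_def)
      then show ?thesis using 1 by blast
    next
      case (2 L)
      have L: "L \<subseteq> {1..}" using \<open>L \<subseteq> M\<close> \<open>M \<subseteq> {1..}\<close> by blast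
      have thin: "\<exists>s. init_seg s I \<and> s \<in> Fpow {1..} - F \<and> s \<in> ?A \<and>
          (\<forall>t. init_seg t I \<and> t \<in> ?A \<longrightarrow> t = s)" if I: "I \<subseteq> L \<and> infinite I" for I
      proof -
        \<comment> \<open>Galvin's lemma supplies existence outside \<open>F\<close>; uniqueness
          comes from the front property of the whole family \<open>?A\<close>.\<close>
        obtain s where s: "s \<in> ?A" "s \<notin> F" "init_seg s I" using 2(3) I by blast
        moreover have "I \<subseteq> {1..}" using I L by blast
        then have "\<exists>!s. s \<in> ?A \<and> init_seg s I" using A I unfolding front_def by blast
        moreover have "s \<in> Fpow {1..}" using A s(1) unfolding front_def by blast
        ultimately show ?thesis by blast
      qed
      show ?thesis
        by (rule exI[of _ L], intro conjI L \<open>infinite L\<close>, rule disjI2,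
            rule exI[of _ "omega_pow a"], intro allI impI, erule thin)
    qed
  qed
qed

end
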